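(* (i) Every graph $G$ with $\alpha(G)=2$ and $\mathrm{had}(G)<|V(G)|/2$ satisfies $\mathrm{had}(G)<\chi(G)$, and every minimal counterexample $G$ to $\mathrm{HC}_{\alpha=2}$ satisfies $\mathrm{had}(G)<|V(G)|/2$; consequently, the statement "every graph $G$ with $\alpha(G)=2$ has $\mathrm{had}(G)\ge\chi(G)$" is equivalent to the statement "every graph $G$ with $\alpha(G)=2$ has $\mathrm{had}(G)\ge|V(G)|/2$". (ii) Every graph $G$ with $\alpha(G)=2$ and $\mathrm{had}_2(G)<\lceil|V(G)|/2\rceil$ satisfies $\mathrm{had}_2(G)<\chi(G)$, and every minimal counterexample $G$ to $\mathrm{SHC}_{\alpha=2}$ satisfies $\mathrm{had}_2(G)<\lceil|V(G)|/2\rceil$; consequently, the statement "every graph $G$ with $\alpha(G)=2$ has $\mathrm{had}_2(G)\ge\chi(G)$" is equivalent to the statement "every graph $G$ with $\alpha(G)=2$ has $\mathrm{had}_2(G)\ge\lceil|V(G)|/2\rceil$". (iii) If every connected graph $G$ with $\alpha(G)=2$ has a non-empty connected dominating matching, then every graph $G$ with $\alpha(G)=2$ has $\mathrm{had}_2(G)\ge\chi(G)$; and if every graph $G$ with $\alpha(G)=2$ has $\mathrm{had}_2(G)\ge\chi(G)$, then every graph $G$ with $\alpha(G)=2$ has $\mathrm{had}(G)\ge\chi(G)$.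
   Context: All graphs are finite and simple. $\mathrm{had}(G)$ is the largest $t$ such that $K_t$ is a minor of $G$; $\mathrm{had}_2(G)$ is the largest $t$ such that $G$ has a model of $K_t$ (pairwise disjoint vertex sets, each inducing a connected subgraph, with an edge between every two of them) in which every branch set has one or two vertices. A counterexample to $\mathrm{HC}_{\alpha=2}$ is a graph $G$ with $\alpha(G)=2$ and $\mathrm{had}(G)<\chi(G)$; a counterexample to $\mathrm{SHC}_{\alpha=2}$ is a graph with $\alpha(G)=2$ and $\mathrm{had}_2(G)<\chi(G)$; a minimal counterexample is a counterexample none of whose proper induced subgraphs is a counterexample. A matching $M$ is connected if for any two edges $e,f\in M$ some endpoint of $e$ is adjacent to some endpoint of $f$; it is dominating if every vertex not covered by $M$ is adjacent to at least one endpoint of each edge of $M$. *)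

theory Defs
  imports "Graph_Theory.Graph_Theory"
begin

text \<open>
  A finite simple graph is a value \<open>G\<close> with \<^term>\<open>pair_graph G\<close>: a finite vertex set
  and a finite, symmetric, irreflexive set of arcs, so that \<open>u\<close> and \<open>v\<close> are adjacent
  iff \<^term>\<open>(u, v) \<in> parcs G\<close>.
\<close>

definition indep_set :: "'a pair_pre_digraph \<Rightarrow> 'a set \<Rightarrow> bool" where
  "indep_set G S \<longleftrightarrow> S \<subseteq> pverts G \<and> (\<forall>u\<in>S. \<forall>v\<in>S. (u, v) \<notin> parcs G)"

definition independence_number :: "'a pair_pre_digraph \<Rightarrow> nat" where
  "independence_number G = Max {card S |S. indep_set G S}"

definition proper_colouring :: "'a pair_pre_digraph \<Rightarrow> nat \<Rightarrow> ('a \<Rightarrow> nat) \<Rightarrow> bool" where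
  "proper_colouring G k c \<longleftrightarrow>
     (\<forall>v\<in>pverts G. c v < k) \<and> (\<forall>(u, v)\<in>parcs G. c u \<noteq> c v)"

definition chromatic_number :: "'a pair_pre_digraph \<Rightarrow> nat" where
  "chromatic_number G = (LEAST k. \<exists>c. proper_colouring G k c)"

definition complete_graph :: "nat \<Rightarrow> nat pair_pre_digraph" where
  "complete_graph t = \<lparr>pverts = {..<t}, parcs = {(i, j). i < t \<and> j < t \<and> i \<noteq> j}\<rparr>"

text \<open>
  \<open>B x\<close> is the branch set of the vertex \<open>x\<close> of \<open>H\<close>. Branch sets are nonempty, since
  \<^const>\<open>Digraph_Component.connected\<close> requires a nonempty vertex set.
\<close>

definition is_model :: "'b pair_pre_digraph \<Rightarrow> 'a pair_pre_digraph \<Rightarrow> ('b \<Rightarrow> 'a set) \<Rightarrow> bool" where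
  "is_model H G B \<longleftrightarrow>
     (\<forall>x\<in>pverts H. B x \<subseteq> pverts G \<and> Digraph_Component.connected (with_proj G \<restriction> B x)) \<and>
     (\<forall>x\<in>pverts H. \<forall>y\<in>pverts H. x \<noteq> y \<longrightarrow> B x \<inter> B y = {}) \<and>
     (\<forall>(x, y)\<in>parcs H. \<exists>u\<in>B x. \<exists>v\<in>B y. (u, v) \<in> parcs G)"

definition is_minor :: "'b pair_pre_digraph \<Rightarrow> 'a pair_pre_digraph \<Rightarrow> bool" where
  "is_minor H G \<longleftrightarrow> (\<exists>B. is_model H G B)"

definition had :: "'a pair_pre_digraph \<Rightarrow> nat" where
  "had G = Max {t. is_minor (complete_graph t) G}"

definition had2 :: "'a pair_pre_digraph \<Rightarrow> nat" where
  "had2 G = Max {t. \<exists>B. is_model (complete_graph t) G B \<and>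
                        (\<forall>x\<in>pverts (complete_graph t). card (B x) = 1 \<or> card (B x) = 2)}"

definition HC_counterexample :: "'a pair_pre_digraph \<Rightarrow> bool" where
  "HC_counterexample G \<longleftrightarrow>
     pair_graph G \<and> independence_number G = 2 \<and> had G < chromatic_number G"

definition SHC_counterexample :: "'a pair_pre_digraph \<Rightarrow> bool" where
  "SHC_counterexample G \<longleftrightarrow>
     pair_graph G \<and> independence_number G = 2 \<and> had2 G < chromatic_number G"

definition induced_minimal ::
    "('a pair_pre_digraph \<Rightarrow> bool) \<Rightarrow> 'a pair_pre_digraph \<Rightarrow> bool" where
  "induced_minimal P G \<longleftrightarrow>
     P G \<and> (\<forall>H. induced_subgraph (with_proj H) (with_proj G) \<and> H \<noteq> G \<longrightarrow> \<not> P H)"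

definition edge_set :: "'a pair_pre_digraph \<Rightarrow> 'a set set" where
  "edge_set G = {{u, v} |u v. (u, v) \<in> parcs G}"

definition is_matching :: "'a pair_pre_digraph \<Rightarrow> 'a set set \<Rightarrow> bool" where
  "is_matching G M \<longleftrightarrow> M \<subseteq> edge_set G \<and> (\<forall>e\<in>M. \<forall>f\<in>M. e \<noteq> f \<longrightarrow> e \<inter> f = {})"

definition connected_matching :: "'a pair_pre_digraph \<Rightarrow> 'a set set \<Rightarrow> bool" where
  "connected_matching G M \<longleftrightarrow>
     is_matching G M \<and>
     (\<forall>e\<in>M. \<forall>f\<in>M. e \<noteq> f \<longrightarrow> (\<exists>u\<in>e. \<exists>v\<in>f. (u, v) \<in> parcs G))"

definition dominating_matching :: "'a pair_pre_digraph \<Rightarrow> 'a set set \<Rightarrow> bool" where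
  "dominating_matching G M \<longleftrightarrow>
     is_matching G M \<and>
     (\<forall>v\<in>pverts G - \<Union>M. \<forall>e\<in>M. \<exists>u\<in>e. (v, u) \<in> parcs G)"

lemma complete_graph_K: "K\<^bsub>t\<^esub> (with_proj (complete_graph t))"
  by (auto simp: complete_digraph_pair_def complete_graph_def)

text \<open>The sets whose maximum or least element is taken above are finite and nonempty.\<close>

lemma independence_number_wf:
  assumes "pair_graph G"
  shows "finite {card S |S. indep_set G S}" "{card S |S. indep_set G S} \<noteq> {}"
proof -
  have fin: "finite (pverts G)"
    using assms by (simp add: pair_graph_def pair_digraph_def pair_fin_digraph_def
      pair_fin_digraph_axioms_def)
  have "{card S |S. indep_set G S} \<subseteq> card ` Pow (pverts G)"
    by (auto simp: indep_set_def)
  then show "finite {card S |S. indep_set G S}"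
    using fin by (meson finite_Pow_iff finite_imageI finite_subset)
  have "indep_set G {}" by (simp add: indep_set_def)
  then show "{card S |S. indep_set G S} \<noteq> {}" by blast
qed

lemma chromatic_number_wf:
  assumes "pair_graph G"
  shows "\<exists>k c. proper_colouring G k c"
proof -
  interpret pair_graph G by fact
  obtain c where c: "bij_betw c (pverts G) {0..<card (pverts G)}"
    using ex_bij_betw_finite_nat[OF pair_finite_verts] by blast
  have "proper_colouring G (card (pverts G)) c"
    unfolding proper_colouring_def
  proof (intro conjI ballI)
    fix v assume "v \<in> pverts G"
    then show "c v < card (pverts G)" using bij_betwE[OF c] by auto
  next
    fix e assume e: "e \<in> parcs G"
    then have "fst e \<in> pverts G" "snd e \<in> pverts G" "fst e \<noteq> snd e"
      using arc_fst_in_verts arc_snd_in_verts pair_no_loops by auto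
    then have "c (fst e) \<noteq> c (snd e)"
      using c by (auto simp: bij_betw_def dest: inj_onD)
    then show "case e of (u, v) \<Rightarrow> c u \<noteq> c v" by (simp add: case_prod_beta)
  qed
  then show ?thesis by blast
qed

lemma is_model_complete_graph_le:
  assumes "pair_graph G" and B: "is_model (complete_graph t) G B"
  shows "t \<le> card (pverts G)"
proof -
  interpret pair_graph G by fact
  have *: "\<exists>v. v \<in> B i" if "i < t" for i
  proof -
    have "Digraph_Component.connected (with_proj G \<restriction> B i)"
      using B that by (simp add: is_model_def complete_graph_def)
    then show ?thesis
      by (auto simp: Digraph_Component.connected_def strongly_connected_def mk_symmetric_def)
  qed
  then obtain h where h: "\<And>i. i < t \<Longrightarrow> h i \<in> B i" by metis
  have "inj_on h {..<t}"
  proof (rule inj_onI, rule ccontr)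
    fix i j assume ij: "i \<in> {..<t}" "j \<in> {..<t}" "h i = h j" "i \<noteq> j"
    then have "B i \<inter> B j = {}"
      using B by (simp add: is_model_def complete_graph_def)
    with h[of i] h[of j] ij show False by auto
  qed
  moreover have "h ` {..<t} \<subseteq> pverts G"
  proof
    fix v assume "v \<in> h ` {..<t}"
    then obtain i where i: "i < t" "v = h i" by auto
    then have "B i \<subseteq> pverts G"
      using B by (simp add: is_model_def complete_graph_def)
    with h[of i] i show "v \<in> pverts G" by auto
  qed
  ultimately show ?thesis
    using card_inj_on_le[OF _ _ pair_finite_verts, of h "{..<t}"] by simp
qed

lemma had_wf:
  assumes "pair_graph G"
  shows "finite {t. is_minor (complete_graph t) G}" "is_minor (complete_graph 0) G"
proof -
  have "{t. is_minor (complete_graph t) G} \<subseteq> {..card (pverts G)}"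
    using is_model_complete_graph_le[OF assms] by (auto simp: is_minor_def)
  then show "finite {t. is_minor (complete_graph t) G}"
    by (rule finite_subset) simp
qed (simp add: is_minor_def is_model_def complete_graph_def)

lemma had2_wf:
  assumes "pair_graph G"
  shows "finite {t. \<exists>B. is_model (complete_graph t) G B \<and>
                        (\<forall>x\<in>pverts (complete_graph t). card (B x) = 1 \<or> card (B x) = 2)}"
    and "\<exists>B. is_model (complete_graph 0) G B \<and>
             (\<forall>x\<in>pverts (complete_graph 0). card (B x) = 1 \<or> card (B x) = 2)"
proof -
  have "{t. \<exists>B. is_model (complete_graph t) G B \<and>
               (\<forall>x\<in>pverts (complete_graph t). card (B x) = 1 \<or> card (B x) = 2)}
        \<subseteq> {..card (pverts G)}"
    using is_model_complete_graph_le[OF assms] by auto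
  then show "finite {t. \<exists>B. is_model (complete_graph t) G B \<and>
                        (\<forall>x\<in>pverts (complete_graph t). card (B x) = 1 \<or> card (B x) = 2)}"
    by (rule finite_subset) simp
qed (simp add: is_model_def complete_graph_def)

end

theory Submission
  imports Defs
begin

text \<open>
  If \<open>\<alpha>(G) \<le> 2\<close>, colour classes have at most two vertices, so colourings of \<open>G\<close> are matchings
  of its complement and \<open>2 \<chi>(G) = n + d\<close>, where \<open>d\<close> is the number of vertices missed by a
  maximum matching. A minimal counterexample is vertex-critical, so every vertex is missed by
  some maximum matching. If \<open>d \<ge> 2\<close>, Gallai's lemma shows that the complement is disconnected,
  that is, \<open>G\<close> is the join of two proper induced subgraphs; their complete minors and colourings
  combine, so \<open>G\<close> is no counterexample. Hence \<open>d \<le> 1\<close>, which gives \<open>had(G) < n/2\<close>.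

  A connected dominating matching \<open>M\<close> contributes \<open>|M|\<close> branch sets of size two to any model of a
  complete graph in \<open>G - V(M)\<close>; a disconnected graph with \<open>\<alpha> \<le> 2\<close> is the union of two cliques.
\<close>

section \<open>Elementary facts on finite simple graphs\<close>

lemma pair_graph_finite: "pair_graph G \<Longrightarrow> finite (pverts G)"
  by (simp add: pair_graph_def pair_digraph_def pair_fin_digraph_def pair_fin_digraph_axioms_def)

lemma pair_graph_arc_verts:
  assumes "pair_graph G" "(u, v) \<in> parcs G"
  shows "u \<in> pverts G" "v \<in> pverts G" "u \<noteq> v"
proof -
  interpret pair_graph G by fact
  show "u \<in> pverts G" "v \<in> pverts G" "u \<noteq> v"
    using assms(2) in_arcsD1 in_arcsD2 no_loops' by blast+
qed

lemma pair_graph_sym: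
  assumes "pair_graph G" "(u, v) \<in> parcs G"
  shows "(v, u) \<in> parcs G"
proof -
  interpret pair_graph G by fact
  show ?thesis using assms(2) by (rule arcs_symmetric)
qed

section \<open>Induced subgraphs\<close>

definition induced :: "'a pair_pre_digraph \<Rightarrow> 'a set \<Rightarrow> 'a pair_pre_digraph" where
  "induced G S = \<lparr>pverts = S, parcs = {(u, v) \<in> parcs G. u \<in> S \<and> v \<in> S}\<rparr>"

lemma pverts_induced [simp]: "pverts (induced G S) = S"
  by (simp add: induced_def)

lemma parcs_induced [simp]: "(u, v) \<in> parcs (induced G S) \<longleftrightarrow> (u, v) \<in> parcs G \<and> u \<in> S \<and> v \<in> S"
  by (simp add: induced_def)

lemma pair_graph_induced:
  assumes G: "pair_graph G" and S: "S \<subseteq> pverts G"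
  shows "pair_graph (induced G S)"
proof -
  interpret pair_graph G by fact
  have "finite S" using S pair_graph_finite[OF G] finite_subset by blast
  moreover have "parcs (induced G S) \<subseteq> parcs G" by (auto simp: induced_def)
  then have "finite (parcs (induced G S))" using pair_finite_arcs finite_subset by blast
  ultimately show ?thesis
    by unfold_locales
      (auto simp: symmetric_def sym_def intro: pair_graph_sym[OF G] dest: pair_graph_arc_verts[OF G])
qed

lemma induced_subgraph_induced:
  assumes G: "pair_graph G" and S: "S \<subseteq> pverts G"
  shows "induced_subgraph (with_proj (induced G S)) (with_proj G)"
proof -
  interpret G: pair_graph G by fact
  interpret H: pair_graph "induced G S" by (rule pair_graph_induced[OF G S])
  show ?thesis
    using S G.wf_digraph H.wf_digraph
    by (auto simp: induced_subgraph_def subgraph_def)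
qed

text \<open>An induced subgraph is determined by its vertex set, so differing from \<open>G\<close>
  forces a strict inclusion of vertices.\<close>

lemma induced_subgraph_card_less:
  assumes G: "pair_graph G" and H: "induced_subgraph (with_proj H) (with_proj G)" "H \<noteq> G"
  shows "card (pverts H) < card (pverts G)"
proof (rule psubset_card_mono[OF pair_graph_finite[OF G]])
  have sub: "pverts H \<subseteq> pverts G"
    and arcs: "parcs H = {e \<in> parcs G. fst e \<in> pverts H \<and> snd e \<in> pverts H}"
    using H(1) by (auto simp: induced_subgraph_def subgraph_def)
  have "pverts H \<noteq> pverts G"
  proof
    assume eq: "pverts H = pverts G"
    then have "parcs H = parcs G"
      using arcs pair_graph_arc_verts[OF G] by auto
    with eq H(2) show False by simp
  qed
  with sub show "pverts H \<subset> pverts G" by blast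
qed

lemma card_le_independence_number:
  assumes "pair_graph G" "indep_set G S"
  shows "card S \<le> independence_number G"
  unfolding independence_number_def
  by (rule Max_ge[OF independence_number_wf(1)[OF assms(1)]]) (use assms(2) in blast)

lemma indep_set_induced:
  assumes "S \<subseteq> pverts G" "indep_set (induced G S) T"
  shows "indep_set G T"
proof -
  have "T \<subseteq> S" and "\<forall>u\<in>T. \<forall>v\<in>T. (u, v) \<notin> parcs (induced G S)"
    using assms(2) by (auto simp only: indep_set_def pverts_induced)
  then show ?thesis using assms(1) unfolding indep_set_def parcs_induced by blast
qed

lemma independence_number_induced_le:
  assumes G: "pair_graph G" and S: "S \<subseteq> pverts G"
  shows "independence_number (induced G S) \<le> independence_number G"
proof -
  have "independence_number (induced G S) \<in> {card T |T. indep_set (induced G S) T}"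
    unfolding independence_number_def
    by (intro Max_in independence_number_wf[OF pair_graph_induced[OF G S]])
  then obtain T where "indep_set (induced G S) T" "independence_number (induced G S) = card T"
    by blast
  then show ?thesis
    using card_le_independence_number[OF G indep_set_induced[OF S]] by simp
qed

lemma adjacent_if_independence_number_le_1:
  assumes G: "pair_graph G" and "independence_number G \<le> 1"
    and uv: "u \<in> pverts G" "v \<in> pverts G" "u \<noteq> v"
  shows "(u, v) \<in> parcs G"
proof (rule ccontr)
  assume "(u, v) \<notin> parcs G"
  then have "indep_set G {u, v}"
    using uv pair_graph_sym[OF G] pair_graph_arc_verts(3)[OF G] by (auto simp: indep_set_def)
  from card_le_independence_number[OF G this] show False
    using assms(2) uv(3) by simp
qed

section \<open>Complete minors with restricted branch sets\<close>

text \<open>The indexing of branch sets is dropped: a model of a complete graph is just the set of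
  its branch sets, so models can be combined by plain unions without renumbering.\<close>

definition clique_model :: "'a pair_pre_digraph \<Rightarrow> 'a set set \<Rightarrow> bool" where
  "clique_model G F \<longleftrightarrow>
     (\<forall>B\<in>F. B \<subseteq> pverts G \<and> Digraph_Component.connected (with_proj G \<restriction> B)) \<and>
     (\<forall>A\<in>F. \<forall>B\<in>F. A \<noteq> B \<longrightarrow> A \<inter> B = {} \<and> (\<exists>u\<in>A. \<exists>v\<in>B. (u, v) \<in> parcs G))"

text \<open>The restriction \<open>Q\<close> on branch sets allows one argument for both parameters:
  \<open>had\<close> is the case where \<open>Q\<close> is always true, \<open>had2\<close> the case
  of one or two vertices.\<close>

definition hadwiger_in :: "('a set \<Rightarrow> bool) \<Rightarrow> 'a pair_pre_digraph \<Rightarrow> nat" where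
  "hadwiger_in Q G = Max {card F |F. clique_model G F \<and> (\<forall>B\<in>F. Q B)}"

lemma connected_imp_verts_nonempty:
  "Digraph_Component.connected H \<Longrightarrow> verts H \<noteq> {}"
  by (auto simp: Digraph_Component.connected_def strongly_connected_def mk_symmetric_def)

lemma clique_model_nonempty: "clique_model G F \<Longrightarrow> B \<in> F \<Longrightarrow> B \<noteq> {}"
  using connected_imp_verts_nonempty unfolding clique_model_def by fastforce

lemma clique_model_finite:
  assumes "pair_graph G" "clique_model G F"
  shows "finite F"
proof -
  have "F \<subseteq> Pow (pverts G)" using assms(2) by (auto simp: clique_model_def)
  then show ?thesis using pair_graph_finite[OF assms(1)] finite_subset by blast
qed

text \<open>Branch sets of distinct indices are disjoint and joined by an edge, hence different; so
  the indexing is injective and its image has \<open>t\<close> members. Conversely, any enumeration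
  of the family is a model.\<close>

lemma is_model_complete_graph_iff_clique_model:
  assumes G: "pair_graph G"
  shows "(\<exists>B. is_model (complete_graph t) G B \<and> (\<forall>x\<in>pverts (complete_graph t). Q (B x)))
     \<longleftrightarrow> (\<exists>F. card F = t \<and> clique_model G F \<and> (\<forall>B\<in>F. Q B))" (is "?L \<longleftrightarrow> ?R")
proof
  assume ?L
  then obtain B where B: "is_model (complete_graph t) G B" and Q: "\<And>x. x < t \<Longrightarrow> Q (B x)"
    by (auto simp: complete_graph_def)
  have conn: "B x \<subseteq> pverts G \<and> Digraph_Component.connected (with_proj G \<restriction> B x)" if "x < t" for x
    using B that by (auto simp: is_model_def complete_graph_def)
  have disj: "B x \<inter> B y = {} \<and> (\<exists>u\<in>B x. \<exists>v\<in>B y. (u, v) \<in> parcs G)"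
    if "x < t" "y < t" "x \<noteq> y" for x y
    using B that by (auto simp: is_model_def complete_graph_def)
  have "inj_on B {..<t}"
  proof (rule inj_onI, rule ccontr)
    fix x y assume "x \<in> {..<t}" "y \<in> {..<t}" "B x = B y" "x \<noteq> y"
    with disj[of x y] show False by blast
  qed
  then have "card (B ` {..<t}) = t" by (simp add: card_image)
  moreover have "clique_model G (B ` {..<t})"
    unfolding clique_model_def
  proof (rule conjI; intro ballI impI)
    fix X assume "X \<in> B ` {..<t}"
    then show "X \<subseteq> pverts G \<and> Digraph_Component.connected (with_proj G \<restriction> X)"
      using conn by blast
  next
    fix X Y assume "X \<in> B ` {..<t}" "Y \<in> B ` {..<t}" "X \<noteq> Y"
    then obtain x y where "X = B x" "Y = B y" "x < t" "y < t" "x \<noteq> y" by blast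
    then show "X \<inter> Y = {} \<and> (\<exists>u\<in>X. \<exists>v\<in>Y. (u, v) \<in> parcs G)"
      using disj[of x y] by simp
  qed
  ultimately show ?R using Q by (intro exI[of _ "B ` {..<t}"]) auto
next
  assume ?R
  then obtain F where F: "card F = t" "clique_model G F" "\<forall>B\<in>F. Q B" by blast
  obtain B where B: "bij_betw B {0..<t} F"
    using ex_bij_betw_nat_finite[OF clique_model_finite[OF G F(2)]] F(1) by blast
  have in_F: "B x \<in> F" if "x < t" for x using bij_betwE[OF B] that by auto
  have neq: "B x \<noteq> B y" if "x < t" "y < t" "x \<noteq> y" for x y
    using B that by (auto simp: bij_betw_def dest: inj_onD)
  have "is_model (complete_graph t) G B"
    unfolding is_model_def
  proof (intro conjI ballI impI)
    fix x assume "x \<in> pverts (complete_graph t)"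
    then have "B x \<in> F" using in_F by (simp add: complete_graph_def)
    then show "B x \<subseteq> pverts G" "Digraph_Component.connected (with_proj G \<restriction> B x)"
      using F(2) by (simp_all add: clique_model_def)
  next
    fix x y assume "x \<in> pverts (complete_graph t)" "y \<in> pverts (complete_graph t)" "x \<noteq> y"
    then show "B x \<inter> B y = {}"
      using F(2) in_F[of x] in_F[of y] neq[of x y] by (simp add: complete_graph_def clique_model_def)
  next
    fix e assume "e \<in> parcs (complete_graph t)"
    then obtain x y where e: "e = (x, y)" "x < t" "y < t" "x \<noteq> y"
      by (auto simp: complete_graph_def)
    then have "\<exists>u\<in>B x. \<exists>v\<in>B y. (u, v) \<in> parcs G"
      using F(2) in_F[of x] in_F[of y] neq[of x y] by (simp add: clique_model_def)
    then show "case e of (x, y) \<Rightarrow> \<exists>u\<in>B x. \<exists>v\<in>B y. (u, v) \<in> parcs G"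
      by (simp add: e)
  qed
  then show ?L using in_F F(3) by (intro exI[of _ B]) (auto simp: complete_graph_def)
qed

lemma had_eq_hadwiger_in: "pair_graph G \<Longrightarrow> had G = hadwiger_in (\<lambda>_. True) G"
  using is_model_complete_graph_iff_clique_model[of G _ "\<lambda>_. True"]
  unfolding had_def hadwiger_in_def is_minor_def by (intro arg_cong[of _ _ Max]) auto

lemma had2_eq_hadwiger_in:
  "pair_graph G \<Longrightarrow> had2 G = hadwiger_in (\<lambda>B. card B = 1 \<or> card B = 2) G"
  using is_model_complete_graph_iff_clique_model[of G _ "\<lambda>B. card B = 1 \<or> card B = 2"]
  unfolding had2_def hadwiger_in_def by (intro arg_cong[of _ _ Max]) auto

lemma finite_clique_model_sizes:
  assumes "pair_graph G"
  shows "finite {card F |F. clique_model G F \<and> (\<forall>B\<in>F. Q B)}"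
proof -
  have "{card F |F. clique_model G F \<and> (\<forall>B\<in>F. Q B)} \<subseteq> card ` Pow (Pow (pverts G))"
    by (auto simp: clique_model_def)
  then show ?thesis
    using pair_graph_finite[OF assms] by (meson finite_Pow_iff finite_imageI finite_subset)
qed

lemma card_le_hadwiger_in:
  assumes "pair_graph G" "clique_model G F" "\<And>B. B \<in> F \<Longrightarrow> Q B"
  shows "card F \<le> hadwiger_in Q G"
  unfolding hadwiger_in_def using assms by (intro Max_ge finite_clique_model_sizes) auto

lemma hadwiger_in_attained:
  assumes "pair_graph G"
  obtains F where "clique_model G F" "\<And>B. B \<in> F \<Longrightarrow> Q B" "card F = hadwiger_in Q G"
proof -
  have "clique_model G {}" by (simp add: clique_model_def)
  then have "hadwiger_in Q G \<in> {card F |F. clique_model G F \<and> (\<forall>B\<in>F. Q B)}"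
    unfolding hadwiger_in_def
    by (intro Max_in finite_clique_model_sizes assms) blast
  then show ?thesis using that by auto
qed

lemma hadwiger_in_mono:
  assumes G: "pair_graph G" and "\<And>B. Q B \<Longrightarrow> R B"
  shows "hadwiger_in Q G \<le> hadwiger_in R G"
proof -
  obtain F where "clique_model G F" "\<And>B. B \<in> F \<Longrightarrow> Q B" "card F = hadwiger_in Q G"
    using hadwiger_in_attained[OF G] by metis
  then show ?thesis using card_le_hadwiger_in[OF G, of F R] assms(2) by auto
qed

lemma induced_restrict:
  assumes "B \<subseteq> S"
  shows "with_proj (induced G S) \<restriction> B = with_proj G \<restriction> B"
  using assms by (auto simp: induce_subgraph_def with_proj_def induced_def)

lemma clique_model_induced:
  assumes "S \<subseteq> pverts G"
  shows "clique_model (induced G S) F \<longleftrightarrow> clique_model G F \<and> \<Union>F \<subseteq> S"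
proof (cases "\<Union>F \<subseteq> S")
  case True
  then have sub: "B \<subseteq> S" "B \<subseteq> pverts G" if "B \<in> F" for B using that assms by blast+
  have arc: "(u, v) \<in> parcs (induced G S) \<longleftrightarrow> (u, v) \<in> parcs G"
    if "A \<in> F" "B \<in> F" "u \<in> A" "v \<in> B" for A B u v
    using that sub by auto
  show ?thesis
    unfolding clique_model_def using True sub arc
    by (auto simp: induced_restrict simp del: parcs_induced)
next
  case False
  then show ?thesis by (auto simp: clique_model_def)
qed

lemma hadwiger_in_induced_le:
  assumes G: "pair_graph G" and S: "S \<subseteq> pverts G"
  shows "hadwiger_in Q (induced G S) \<le> hadwiger_in Q G"
proof -
  obtain F where "clique_model (induced G S) F" "\<And>B. B \<in> F \<Longrightarrow> Q B"
    "card F = hadwiger_in Q (induced G S)"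
    using hadwiger_in_attained[OF pair_graph_induced[OF G S]] by metis
  then show ?thesis using card_le_hadwiger_in[OF G, of F Q] clique_model_induced[OF S] by auto
qed

text \<open>Members are nonempty, so disjointness of members across the two families makes the
  families themselves disjoint and their sizes add up.\<close>

lemma clique_model_Un:
  assumes E: "clique_model G E" and F: "clique_model G F"
    and disj: "\<And>A B. A \<in> E \<Longrightarrow> B \<in> F \<Longrightarrow> A \<inter> B = {}"
    and adj: "\<And>A B. A \<in> E \<Longrightarrow> B \<in> F \<Longrightarrow> \<exists>u\<in>A. \<exists>v\<in>B. (u, v) \<in> parcs G"
    and G: "pair_graph G"
  shows "clique_model G (E \<union> F)" "card (E \<union> F) = card E + card F"
proof -
  have cross: "A \<inter> B = {} \<and> (\<exists>u\<in>A. \<exists>v\<in>B. (u, v) \<in> parcs G)"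
    "B \<inter> A = {} \<and> (\<exists>u\<in>B. \<exists>v\<in>A. (u, v) \<in> parcs G)"
    if "A \<in> E" "B \<in> F" for A B
    using disj[OF that] adj[OF that] pair_graph_sym[OF G] by blast+
  show "clique_model G (E \<union> F)"
    unfolding clique_model_def
  proof (rule conjI; intro ballI impI)
    fix B assume "B \<in> E \<union> F"
    then show "B \<subseteq> pverts G \<and> Digraph_Component.connected (with_proj G \<restriction> B)"
      using E F unfolding clique_model_def by blast
  next
    fix A B assume "A \<in> E \<union> F" "B \<in> E \<union> F" "A \<noteq> B"
    then consider "A \<in> E" "B \<in> E" | "A \<in> F" "B \<in> F" | "A \<in> E" "B \<in> F" | "A \<in> F" "B \<in> E"
      by blast
    then show "A \<inter> B = {} \<and> (\<exists>u\<in>A. \<exists>v\<in>B. (u, v) \<in> parcs G)"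
    proof cases
      case 1
      then show ?thesis using E \<open>A \<noteq> B\<close> by (simp add: clique_model_def)
    next
      case 2
      then show ?thesis using F \<open>A \<noteq> B\<close> by (simp add: clique_model_def)
    next
      case 3
      then show ?thesis by (rule cross(1))
    next
      case 4
      then show ?thesis by (rule cross(2)[rotated])
    qed
  qed
  have "E \<inter> F = {}"
    using disj clique_model_nonempty[OF E] by fastforce
  then show "card (E \<union> F) = card E + card F"
    using clique_model_finite[OF G E] clique_model_finite[OF G F] by (simp add: card_Un_disjoint)
qed

text \<open>Every branch set inside \<open>A\<close> is adjacent to every branch set inside
  \<open>B\<close> because all edges between the sides are present; largest models of the two sides
  can therefore be united.\<close>

lemma hadwiger_in_join:
  assumes G: "pair_graph G" and AB: "A \<subseteq> pverts G" "B \<subseteq> pverts G" "A \<inter> B = {}"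
    and join: "\<And>a b. a \<in> A \<Longrightarrow> b \<in> B \<Longrightarrow> (a, b) \<in> parcs G"
  shows "hadwiger_in Q (induced G A) + hadwiger_in Q (induced G B) \<le> hadwiger_in Q G"
proof -
  obtain E where E: "clique_model (induced G A) E" "\<And>X. X \<in> E \<Longrightarrow> Q X"
    "card E = hadwiger_in Q (induced G A)"
    using hadwiger_in_attained[OF pair_graph_induced[OF G AB(1)]] by metis
  obtain F where F: "clique_model (induced G B) F" "\<And>X. X \<in> F \<Longrightarrow> Q X"
    "card F = hadwiger_in Q (induced G B)"
    using hadwiger_in_attained[OF pair_graph_induced[OF G AB(2)]] by metis
  have EF: "clique_model G E" "\<Union>E \<subseteq> A" "clique_model G F" "\<Union>F \<subseteq> B"
    using E(1) F(1) clique_model_induced AB by blast+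
  have "X \<inter> Y = {}" if "X \<in> E" "Y \<in> F" for X Y
    using that EF AB(3) by blast
  moreover have "\<exists>u\<in>X. \<exists>v\<in>Y. (u, v) \<in> parcs G" if XY: "X \<in> E" "Y \<in> F" for X Y
  proof -
    obtain x y where "x \<in> X" "y \<in> Y"
      using clique_model_nonempty[OF EF(1) XY(1)] clique_model_nonempty[OF EF(3) XY(2)] by blast
    then show ?thesis using XY EF join by blast
  qed
  ultimately have "clique_model G (E \<union> F)" "card (E \<union> F) = card E + card F"
    using clique_model_Un[OF EF(1,3) _ _ G] by blast+
  then show ?thesis
    using card_le_hadwiger_in[OF G, of "E \<union> F" Q] E F by auto
qed

section \<open>Connected branch sets with one or two vertices\<close>

lemma connected_singleton: "Digraph_Component.connected (with_proj G \<restriction> {v})"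
  by (auto simp: Digraph_Component.connected_def strongly_connected_def mk_symmetric_def
      reachable_def)

lemma connected_edge:
  assumes "(u, v) \<in> parcs G"
  shows "Digraph_Component.connected (with_proj G \<restriction> {u, v})"
proof -
  let ?H = "mk_symmetric (with_proj G \<restriction> {u, v})"
  have V: "pverts ?H = {u, v}" and A: "(u, v) \<in> parcs ?H" "(v, u) \<in> parcs ?H"
    using assms by (force simp: mk_symmetric_def)+
  interpret wf_digraph "with_proj ?H"
    by unfold_locales (auto simp: mk_symmetric_def)
  have "u \<rightarrow>\<^sup>*\<^bsub>with_proj ?H\<^esub> v" "v \<rightarrow>\<^sup>*\<^bsub>with_proj ?H\<^esub> u"
    using A by (intro reachable_adjI; simp)+
  then show ?thesis
    unfolding Digraph_Component.connected_def strongly_connected_def using V by auto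
qed

lemma card_le_hadwiger_in_if_complete:
  assumes G: "pair_graph G" and Q: "\<And>v. Q {v}"
    and compl: "\<And>u v. u \<in> pverts G \<Longrightarrow> v \<in> pverts G \<Longrightarrow> u \<noteq> v \<Longrightarrow> (u, v) \<in> parcs G"
  shows "card (pverts G) \<le> hadwiger_in Q G"
proof -
  have "clique_model G ((\<lambda>v. {v}) ` pverts G)"
    using compl connected_singleton by (auto simp: clique_model_def)
  from card_le_hadwiger_in[OF G this, of Q] show ?thesis
    using Q by (auto simp: card_image)
qed

section \<open>Colourings and matchings of the complement\<close>

text \<open>A matching of the complement is encoded as an involution whose fixed points are the
  unmatched vertices.\<close>

definition pairing :: "'a pair_pre_digraph \<Rightarrow> ('a \<Rightarrow> 'a) \<Rightarrow> bool" where
  "pairing G f \<longleftrightarrow> (\<forall>v\<in>pverts G. f v \<in> pverts G \<and> f (f v) = v \<and> (v, f v) \<notin> parcs G)"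

definition unpaired :: "'a pair_pre_digraph \<Rightarrow> ('a \<Rightarrow> 'a) \<Rightarrow> 'a set" where
  "unpaired G f = {v \<in> pverts G. f v = v}"

text \<open>The weights, 2 for a fixed point and 1 for a moved vertex, are chosen so that every
  orbit \<open>{v, f v}\<close> of an involution has total weight exactly 2. Twice the number of
  orbits is then this sum.\<close>

lemma card_plus_card_unpaired:
  assumes "finite (pverts G)"
  shows "card (pverts G) + card (unpaired G f) = (\<Sum>v\<in>pverts G. if f v = v then 2 else 1)"
proof -
  have "(\<Sum>v\<in>pverts G. if f v = v then 2 else 1)
      = (\<Sum>v\<in>pverts G. 1 + (if f v = v then 1 else 0 :: nat))"
    by (intro sum.cong) auto
  also have "\<dots> = card (pverts G) + card (unpaired G f)"
    using assms by (simp add: sum_Suc unpaired_def sum.If_cases Int_def)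
  finally show ?thesis by simp
qed

lemma chromatic_number_le: "proper_colouring G k c \<Longrightarrow> chromatic_number G \<le> k"
  unfolding chromatic_number_def by (rule Least_le) blast

text \<open>The orbits of \<open>f\<close> are independent sets and serve as colour classes.
  Grouping the weights of \<open>card_plus_card_unpaired\<close> by orbit counts each class
  twice.\<close>

lemma chromatic_number_le_pairing:
  assumes G: "pair_graph G" and f: "pairing G f"
  shows "2 * chromatic_number G \<le> card (pverts G) + card (unpaired G f)"
proof -
  let ?p = "\<lambda>v. {v, f v}"
  let ?C = "?p ` pverts G"
  have fin: "finite (pverts G)" by (rule pair_graph_finite[OF G])
  obtain i where i: "bij_betw i ?C {0..<card ?C}"
    using ex_bij_betw_finite_nat[of ?C] fin by blast
  have "proper_colouring G (card ?C) (\<lambda>v. i (?p v))"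
    unfolding proper_colouring_def
  proof (intro conjI ballI, goal_cases)
    case (1 v)
    then show ?case using bij_betwE[OF i] by auto
  next
    case (2 e)
    obtain u v where e: "e = (u, v)" by (cases e)
    have uv: "(u, v) \<in> parcs G" "u \<in> pverts G" "v \<in> pverts G" "u \<noteq> v"
      using 2 e pair_graph_arc_verts[OF G] by auto
    have "i (?p u) \<noteq> i (?p v)"
    proof
      assume "i (?p u) = i (?p v)"
      then have "?p u = ?p v"
        using i uv by (auto simp: bij_betw_def dest!: inj_onD)
      then have "v = f u" using uv(4) by (auto simp: doubleton_eq_iff)
      then show False using f uv by (auto simp: pairing_def)
    qed
    then show ?case by (simp add: e)
  qed
  then have le: "chromatic_number G \<le> card ?C" by (rule chromatic_number_le)
  have "(\<Sum>v\<in>pverts G. if f v = v then 2 else 1)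
      = (\<Sum>B\<in>?C. \<Sum>v\<in>{v\<in>pverts G. ?p v = B}. if f v = v then 2 else 1 :: nat)"
    by (rule sum.image_gen[OF fin])
  also have "\<dots> = (\<Sum>B\<in>?C. 2)"
  proof (rule sum.cong[OF refl])
    fix B assume "B \<in> ?C"
    then obtain w where w: "w \<in> pverts G" "B = ?p w" by blast
    then have "{v\<in>pverts G. ?p v = B} = {w, f w}"
      using f by (auto simp: pairing_def doubleton_eq_iff)
    then show "(\<Sum>v\<in>{v\<in>pverts G. ?p v = B}. if f v = v then 2 else 1 :: nat) = 2"
      using w f by (cases "f w = w") (auto simp: pairing_def)
  qed
  finally show ?thesis using le card_plus_card_unpaired[OF fin, of f] by simp
qed

text \<open>A colour class is independent, so it has at most two vertices; \<open>f\<close> swaps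
  the two vertices of a full class and fixes a vertex that is alone in its class.\<close>

lemma pairing_le_colouring:
  assumes G: "pair_graph G" and \<alpha>: "independence_number G \<le> 2" and c: "proper_colouring G k c"
  obtains f where "pairing G f" "card (pverts G) + card (unpaired G f) \<le> 2 * k"
proof -
  have fin: "finite (pverts G)" by (rule pair_graph_finite[OF G])
  let ?K = "\<lambda>i. {v \<in> pverts G. c v = i}"
  have nonadj: "(u, v) \<notin> parcs G" if "c u = c v" for u v
    using c that by (auto simp: proper_colouring_def)
  have K2: "card (?K i) \<le> 2" for i
    using card_le_independence_number[OF G, of "?K i"] \<alpha> nonadj by (auto simp: indep_set_def)
  have uniq: "x = y" if "v \<in> pverts G" "x \<in> pverts G" "y \<in> pverts G" "x \<noteq> v" "y \<noteq> v"
    "c x = c v" "c y = c v" for v x y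
  proof (rule ccontr)
    assume "x \<noteq> y"
    then have "card {v, x, y} = 3" using that by auto
    moreover have "card {v, x, y} \<le> card (?K (c v))"
      using that fin by (intro card_mono) auto
    ultimately show False using K2[of "c v"] by simp
  qed
  \<comment> \<open>The choice is harmless for vertices of \<open>G\<close>: by \<open>uniq\<close>
    at most one other vertex shares the colour of \<open>v\<close>.\<close>
  define f where "f v = (if \<exists>w\<in>pverts G. w \<noteq> v \<and> c w = c v
    then SOME w. w \<in> pverts G \<and> w \<noteq> v \<and> c w = c v else v)" for v
  have f1: "f v \<in> pverts G \<and> f v \<noteq> v \<and> c (f v) = c v"
    if "w \<in> pverts G" "w \<noteq> v" "c w = c v" for v w
  proof -
    have "f v = (SOME w. w \<in> pverts G \<and> w \<noteq> v \<and> c w = c v)"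
      unfolding f_def using that by auto
    then show ?thesis using someI[of "\<lambda>w. w \<in> pverts G \<and> w \<noteq> v \<and> c w = c v" w] that by simp
  qed
  have f0: "f v = v \<or> f v \<in> pverts G \<and> f v \<noteq> v \<and> c (f v) = c v" for v
  proof (cases "\<exists>w\<in>pverts G. w \<noteq> v \<and> c w = c v")
    case True
    then show ?thesis using f1 by blast
  next
    case False
    then have "f v = v" unfolding f_def by (rule if_not_P)
    then show ?thesis by simp
  qed
  have "pairing G f"
    unfolding pairing_def
  proof (intro ballI conjI)
    fix v assume v: "v \<in> pverts G"
    show "f v \<in> pverts G" using f0[of v] v by auto
    show "(v, f v) \<notin> parcs G" using f0[of v] nonadj[of v "f v"] by auto
    show "f (f v) = v"
    proof (cases "f v = v")
      case False
      then have fv: "f v \<in> pverts G" "c (f v) = c v" using f0[of v] by auto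
      then have ffv: "f (f v) \<in> pverts G" "f (f v) \<noteq> f v" "c (f (f v)) = c (f v)"
        using f1[of v "f v"] v False by auto
      show ?thesis
        by (rule uniq[OF fv(1) ffv(1) v ffv(2) False[symmetric] ffv(3) fv(2)[symmetric]])
    qed simp
  qed
  moreover have "card (pverts G) + card (unpaired G f) \<le> 2 * k"
  proof -
    have "(\<Sum>v\<in>pverts G. if f v = v then 2 else 1)
        = (\<Sum>i\<in>c ` pverts G. \<Sum>v\<in>?K i. if f v = v then 2 else 1 :: nat)"
      by (rule sum.image_gen[OF fin])
    also have "\<dots> \<le> (\<Sum>i\<in>c ` pverts G. 2)"
    proof (rule sum_mono)
      fix i assume "i \<in> c ` pverts G"
      \<comment> \<open>A class with a fixed point is a singleton of weight 2; otherwise it has at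
        most two vertices, each of weight 1.\<close>
      show "(\<Sum>v\<in>?K i. if f v = v then 2 else 1 :: nat) \<le> 2"
      proof (cases "\<exists>v\<in>?K i. f v = v")
        case True
        then obtain v where v: "v \<in> ?K i" "f v = v" by blast
        then have "?K i = {v}" using f1[of _ v] by auto
        then show ?thesis using v by simp
      next
        case False
        then have "(\<Sum>v\<in>?K i. if f v = v then 2 else 1 :: nat) = (\<Sum>v\<in>?K i. 1)"
          by (intro sum.cong) auto
        then show ?thesis using K2[of i] by simp
      qed
    qed
    also have "\<dots> \<le> 2 * k"
    proof -
      have "c ` pverts G \<subseteq> {..<k}" using c by (auto simp: proper_colouring_def)
      from card_mono[OF _ this] show ?thesis by simp
    qed
    finally show ?thesis using card_plus_card_unpaired[OF fin, of f] by simp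
  qed
  ultimately show ?thesis by (rule that)
qed

text \<open>This is a maximum matching of the complement: \<open>chromatic_number_le_pairing\<close>
  bounds the left side from below for every pairing, so equality means that as few vertices as
  possible are unpaired.\<close>

definition optimal_pairing :: "'a pair_pre_digraph \<Rightarrow> ('a \<Rightarrow> 'a) \<Rightarrow> bool" where
  "optimal_pairing G f \<longleftrightarrow>
     pairing G f \<and> card (pverts G) + card (unpaired G f) = 2 * chromatic_number G"

lemma optimal_pairing_exists:
  assumes "pair_graph G" "independence_number G \<le> 2"
  obtains f where "optimal_pairing G f"
proof -
  obtain c where "proper_colouring G (chromatic_number G) c"
    using LeastI_ex[OF chromatic_number_wf[OF assms(1)]] unfolding chromatic_number_def by blast
  then obtain f where "pairing G f"
    "card (pverts G) + card (unpaired G f) \<le> 2 * chromatic_number G"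
    using pairing_le_colouring[OF assms] by blast
  then have "optimal_pairing G f"
    using chromatic_number_le_pairing[OF assms(1)] by (simp add: optimal_pairing_def le_antisym)
  then show ?thesis by (rule that)
qed

lemma optimal_pairing_unpaired_le:
  assumes "pair_graph G" "optimal_pairing G f" "pairing G g"
  shows "card (unpaired G f) \<le> card (unpaired G g)"
  using chromatic_number_le_pairing[OF assms(1,3)] assms(2) by (simp add: optimal_pairing_def)

lemma card_le_twice_chromatic_number:
  assumes "pair_graph G" "independence_number G \<le> 2"
  shows "card (pverts G) \<le> 2 * chromatic_number G"
  using optimal_pairing_exists[OF assms] unfolding optimal_pairing_def by (metis le_add1)

lemma chromatic_number_le_card:
  assumes "pair_graph G"
  shows "chromatic_number G \<le> card (pverts G)"
proof -
  have "pairing G id"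
    using pair_graph_arc_verts(3)[OF assms] by (auto simp: pairing_def)
  moreover have "unpaired G id = pverts G" by (auto simp: unpaired_def)
  ultimately show ?thesis using chromatic_number_le_pairing[OF assms, of id] by simp
qed

text \<open>Optimal pairings of the two sides glue to a pairing of \<open>G\<close> whose unpaired
  vertices are those of the two sides together.\<close>

lemma chromatic_number_Un_le:
  assumes G: "pair_graph G" and \<alpha>: "independence_number G \<le> 2"
    and AB: "A \<union> B = pverts G" "A \<inter> B = {}"
  shows "chromatic_number G \<le> chromatic_number (induced G A) + chromatic_number (induced G B)"
proof -
  have sub: "A \<subseteq> pverts G" "B \<subseteq> pverts G" using AB by auto
  have "independence_number (induced G A) \<le> 2" "independence_number (induced G B) \<le> 2"
    using independence_number_induced_le[OF G] sub \<alpha> le_trans by blast+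
  then obtain f g where f: "optimal_pairing (induced G A) f" and g: "optimal_pairing (induced G B) g"
    using optimal_pairing_exists pair_graph_induced[OF G] sub by metis
  let ?h = "\<lambda>v. if v \<in> A then f v else g v"
  have "pairing G ?h"
    using f g AB unfolding optimal_pairing_def pairing_def by (auto simp flip: AB(1))
  then have "2 * chromatic_number G \<le> card (pverts G) + card (unpaired G ?h)"
    by (rule chromatic_number_le_pairing[OF G])
  also have "card (pverts G) = card A + card B"
    using AB sub finite_subset[OF _ pair_graph_finite[OF G]] by (metis card_Un_disjoint)
  also have "unpaired G ?h = unpaired (induced G A) f \<union> unpaired (induced G B) g"
    using AB by (auto simp: unpaired_def)
  also have "card \<dots> \<le> card (unpaired (induced G A) f) + card (unpaired (induced G B) g)"
    by (rule card_Un_le)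
  finally show ?thesis using f g by (simp add: optimal_pairing_def)
qed

section \<open>Gallai's lemma\<close>

text \<open>Two nonadjacent unpaired vertices could be paired with each other, which would leave
  fewer vertices unpaired.\<close>

lemma optimal_pairing_unpaired_adjacent:
  assumes G: "pair_graph G" and f: "optimal_pairing G f"
    and uv: "u \<in> unpaired G f" "v \<in> unpaired G f" "u \<noteq> v"
  shows "(u, v) \<in> parcs G"
proof (rule ccontr)
  assume "(u, v) \<notin> parcs G"
  then have nonadj: "(u, v) \<notin> parcs G" "(v, u) \<notin> parcs G" using pair_graph_sym[OF G] by auto
  let ?g = "f(u := v, v := u)"
  have V: "u \<in> pverts G" "v \<in> pverts G" "f u = u" "f v = v" using uv by (auto simp: unpaired_def)
  have f_pair: "f x \<in> pverts G" "f (f x) = x" "(x, f x) \<notin> parcs G" if "x \<in> pverts G" for x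
    using f that by (auto simp: optimal_pairing_def pairing_def)
  have "f x \<noteq> u \<and> f x \<noteq> v" if "x \<in> pverts G" "x \<noteq> u" "x \<noteq> v" for x
    using f_pair(2)[OF that(1)] that V by metis
  then have "pairing G ?g"
    using f_pair V nonadj uv(3) by (auto simp: pairing_def)
  from optimal_pairing_unpaired_le[OF G f this]
  have "card (unpaired G f) \<le> card (unpaired G ?g)" .
  moreover have "unpaired G ?g \<subset> unpaired G f"
    using uv by (auto simp: unpaired_def)
  then have "card (unpaired G ?g) < card (unpaired G f)"
    using pair_graph_finite[OF G] by (intro psubset_card_mono) (auto simp: unpaired_def)
  ultimately show False by simp
qed

text \<open>The transitivity step of Gallai's lemma. Among the optimal pairings that leave \<open>v\<close>
  unpaired, one that agrees with \<open>f\<close> as often as possible must leave \<open>u\<close> or \<open>w\<close> unpaired: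
  otherwise it leaves some \<open>x \<noteq> v\<close> unpaired that \<open>f\<close> pairs with a \<open>y\<close>, and re-pairing \<open>y\<close>
  with \<open>x\<close> increases the agreement.\<close>

lemma optimal_pairing_exchange:
  assumes G: "pair_graph G" and f: "optimal_pairing G f" and g0: "optimal_pairing G g0"
    and uw: "u \<in> unpaired G f" "w \<in> unpaired G f" "u \<noteq> w"
    and v: "v \<in> unpaired G g0"
  obtains h where "optimal_pairing G h" "v \<in> unpaired G h" "u \<in> unpaired G h \<or> w \<in> unpaired G h"
proof (rule ccontr)
  assume "\<not> thesis"
  with that have none: "u \<notin> unpaired G h \<and> w \<notin> unpaired G h"
    if "optimal_pairing G h" "v \<in> unpaired G h" for h
    using that by blast
  have fin: "finite (pverts G)" by (rule pair_graph_finite[OF G])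
  then have fin_un: "finite (unpaired G h)" for h by (simp add: unpaired_def)
  \<comment> \<open>Only vertices that \<open>f\<close> really pairs are counted; common fixed
    points do not contribute to the agreement.\<close>
  define agree where "agree h = {a \<in> pverts G. h a = f a \<and> f a \<noteq> a}" for h
  let ?P = "\<lambda>h. optimal_pairing G h \<and> v \<in> unpaired G h"
  have "card (agree h) \<le> card (pverts G)" for h
    using fin by (intro card_mono) (auto simp: agree_def)
  then obtain g where g: "optimal_pairing G g" "v \<in> unpaired G g"
    and g_max: "\<And>h. ?P h \<Longrightarrow> card (agree h) \<le> card (agree g)"
    using ex_has_greatest_nat[of ?P g0 "\<lambda>h. card (agree h)" "Suc (card (pverts G))"] g0 v
    by (metis less_Suc_eq_le)
  have card_eq: "card (unpaired G f) = card (unpaired G g)"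
    using f g(1) by (simp add: optimal_pairing_def)
  have fp: "f x \<in> pverts G" "f (f x) = x" "(x, f x) \<notin> parcs G" if "x \<in> pverts G" for x
    using f that by (auto simp: optimal_pairing_def pairing_def)
  have gp: "g x \<in> pverts G" "g (g x) = x" "(x, g x) \<notin> parcs G" if "x \<in> pverts G" for x
    using g that by (auto simp: optimal_pairing_def pairing_def)
  \<comment> \<open>Both pairings leave equally many vertices unpaired, so \<open>g\<close> also
    misses at least two vertices that \<open>f\<close> pairs, and one of them differs from
    \<open>v\<close>.\<close>
  have "{u, w} \<subseteq> unpaired G f - unpaired G g" using uw none[OF g] by blast
  then have "2 \<le> card (unpaired G f - unpaired G g)"
    using card_mono[of "unpaired G f - unpaired G g" "{u, w}"] fin_un uw(3) by simp
  also have "\<dots> = card (unpaired G g - unpaired G f)"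
    using card_eq by (simp add: card_Diff_subset_Int fin_un Int_commute)
  finally have "\<not> unpaired G g - unpaired G f \<subseteq> {v}"
    using card_mono[of "{v}" "unpaired G g - unpaired G f"] by auto
  then obtain x where x: "x \<in> pverts G" "g x = x" "f x \<noteq> x" "x \<noteq> v"
    by (auto simp: unpaired_def)
  define y where "y = f x"
  have y: "y \<in> pverts G" "f y = x" "y \<noteq> x" "(x, y) \<notin> parcs G" "(y, x) \<notin> parcs G"
    using fp[OF x(1)] x pair_graph_sym[OF G] by (auto simp: y_def)
  \<comment> \<open>Since \<open>x\<close> is unpaired in \<open>g\<close> and not adjacent to
    \<open>y\<close>, optimality of \<open>g\<close> forces \<open>y\<close> to be paired.\<close>
  have "y \<notin> unpaired G g"
    using optimal_pairing_unpaired_adjacent[OF G g(1), of x y] x y by (auto simp: unpaired_def)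
  define z where "z = g y"
  have z: "z \<in> pverts G" "g z = y" "g y = z" "z \<noteq> y" "z \<noteq> x" "z \<noteq> v" "y \<noteq> v"
    using gp[OF y(1)] \<open>y \<notin> unpaired G g\<close> y x g(2) by (auto simp: unpaired_def z_def)
  \<comment> \<open>The pair \<open>{y, z}\<close> is replaced by \<open>{x, y}\<close>, so
    \<open>z\<close> takes over the role of \<open>x\<close> as an unpaired vertex and the number of
    unpaired vertices is unchanged.\<close>
  let ?h = "g(x := y, y := x, z := z)"
  have g_avoids: "g a \<noteq> x \<and> g a \<noteq> y \<and> g a \<noteq> z"
    if "a \<in> pverts G" "a \<noteq> x" "a \<noteq> y" "a \<noteq> z" for a
    using gp(2)[OF that(1)] that x(2) z(2,3) by metis
  have no_loop: "(z, z) \<notin> parcs G" using pair_graph_arc_verts(3)[OF G] by blast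
  have pair_h: "pairing G ?h"
    unfolding pairing_def
  proof (intro ballI)
    fix a assume a: "a \<in> pverts G"
    show "?h a \<in> pverts G \<and> ?h (?h a) = a \<and> (a, ?h a) \<notin> parcs G"
      using g_avoids[OF a] gp[OF a] x y z no_loop
      by (cases "a = x"; cases "a = y"; cases "a = z") auto
  qed
  have "unpaired G ?h = insert z (unpaired G g - {x})"
    using x y z by (auto simp: unpaired_def)
  moreover have "x \<in> unpaired G g" "z \<notin> unpaired G g - {x}"
    using x z by (auto simp: unpaired_def)
  ultimately have "card (unpaired G ?h) = card (unpaired G g)"
    using fin_un[of g] by (metis card.insert card.remove finite_Diff)
  then have "optimal_pairing G ?h"
    using pair_h g(1) by (simp add: optimal_pairing_def)
  moreover have "v \<in> unpaired G ?h" using g(2) x z by (auto simp: unpaired_def)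
  ultimately have "card (agree ?h) \<le> card (agree g)" using g_max by blast
  moreover have "agree g \<subset> agree ?h"
  proof
    \<comment> \<open>The dissolved pair \<open>{y, z}\<close> is not a pair of \<open>f\<close>,
      whose partner of \<open>y\<close> is \<open>x\<close>; so no agreement is lost.\<close>
    have "f z \<noteq> y" using y(2) z fp(2)[OF z(1)] by metis
    then show "agree g \<subseteq> agree ?h"
      using x y z by (auto simp: agree_def y_def z_def)
    have "x \<in> agree ?h" "x \<notin> agree g"
      using x y z by (auto simp: agree_def y_def)
    then show "agree g \<noteq> agree ?h" by blast
  qed
  then have "card (agree g) < card (agree ?h)"
    using fin by (intro psubset_card_mono) (auto simp: agree_def)
  ultimately show False by simp
qed

section \<open>Minimal counterexamples\<close>

definition counterexample_in :: "('a set \<Rightarrow> bool) \<Rightarrow> 'a pair_pre_digraph \<Rightarrow> bool" where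
  "counterexample_in Q G \<longleftrightarrow>
     pair_graph G \<and> independence_number G = 2 \<and> hadwiger_in Q G < chromatic_number G"

lemma HC_counterexample_eq: "HC_counterexample = counterexample_in (\<lambda>_. True)"
  by (auto simp: fun_eq_iff HC_counterexample_def counterexample_in_def had_eq_hadwiger_in)

lemma SHC_counterexample_eq:
  "SHC_counterexample = counterexample_in (\<lambda>B. card B = 1 \<or> card B = 2)"
  by (auto simp: fun_eq_iff SHC_counterexample_def counterexample_in_def had2_eq_hadwiger_in)

lemma minimal_counterexample_hadwiger_in_less:
  assumes min: "induced_minimal (counterexample_in Q) G" and Q: "\<And>v. Q {v}"
  shows "2 * hadwiger_in Q G < card (pverts G)"
proof (rule ccontr)
  assume "\<not> ?thesis"
  then have big: "card (pverts G) \<le> 2 * hadwiger_in Q G" by simp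
  have G: "pair_graph G" and \<alpha>: "independence_number G \<le> 2"
    and less: "hadwiger_in Q G < chromatic_number G"
    using min by (auto simp: induced_minimal_def counterexample_in_def)
  \<comment> \<open>Minimality only speaks of subgraphs with independence number exactly 2. Those
    with smaller independence number are complete and satisfy the bound through singleton branch
    sets.\<close>
  have proper: "chromatic_number (induced G S) \<le> hadwiger_in Q (induced G S)"
    if S: "S \<subset> pverts G" for S
  proof -
    let ?H = "induced G S"
    have H: "pair_graph ?H" "independence_number ?H \<le> 2"
      using S pair_graph_induced[OF G] independence_number_induced_le[OF G, of S] \<alpha> by auto
    show ?thesis
    proof (cases "independence_number ?H \<le> 1")
      case True
      have "card (pverts ?H) \<le> hadwiger_in Q ?H"
        using card_le_hadwiger_in_if_complete[where Q = Q, OF H(1) Q]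
          adjacent_if_independence_number_le_1[OF H(1) True] by blast
      then show ?thesis using chromatic_number_le_card[OF H(1)] by simp
    next
      case False
      have "?H \<noteq> G" using S by (metis pverts_induced less_irrefl)
      then have "\<not> counterexample_in Q ?H"
        using min induced_subgraph_induced[OF G, of S] S by (auto simp: induced_minimal_def)
      then show ?thesis using H False by (auto simp: counterexample_in_def)
    qed
  qed
  \<comment> \<open>Deleting \<open>v\<close> lowers the chromatic number, since by
    \<open>proper\<close> that of \<open>G - v\<close> is at most \<open>hadwiger_in Q G\<close>.
    Hence an optimal pairing of \<open>G - v\<close>, extended by the fixed point \<open>v\<close>
    at the cost of one colour, is optimal for \<open>G\<close>.\<close>
  have critical: "\<exists>f. optimal_pairing G f \<and> v \<in> unpaired G f" if v: "v \<in> pverts G" for v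
  proof -
    let ?S = "pverts G - {v}"
    have S: "?S \<subseteq> pverts G" "?S \<subset> pverts G" using v by auto
    have card_S: "card (pverts G) = Suc (card ?S)"
      by (rule card.remove[OF pair_graph_finite[OF G] v])
    obtain f where f: "optimal_pairing (induced G ?S) f"
      using optimal_pairing_exists[OF pair_graph_induced[OF G S(1)]
          order_trans[OF independence_number_induced_le[OF G S(1)] \<alpha>]] .
    let ?g = "f(v := v)"
    have "(v, v) \<notin> parcs G" using pair_graph_arc_verts(3)[OF G] by blast
    then have pair: "pairing G ?g"
      using f v unfolding optimal_pairing_def pairing_def by auto
    have "unpaired G ?g = insert v (unpaired (induced G ?S) f)"
      using v by (auto simp: unpaired_def)
    moreover have "finite (unpaired (induced G ?S) f)" "v \<notin> unpaired (induced G ?S) f"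
      using pair_graph_finite[OF G] by (auto simp: unpaired_def)
    ultimately have "card (unpaired G ?g) = Suc (card (unpaired (induced G ?S) f))" by simp
    then have "card (pverts G) + card (unpaired G ?g) = 2 * chromatic_number (induced G ?S) + 2"
      using f card_S by (simp add: optimal_pairing_def)
    moreover have "chromatic_number (induced G ?S) \<le> hadwiger_in Q G"
      using proper[OF S(2)] hadwiger_in_induced_le[OF G S(1), of Q] by simp
    ultimately have "optimal_pairing G ?g"
      using pair less chromatic_number_le_pairing[OF G pair] by (simp add: optimal_pairing_def)
    moreover have "v \<in> unpaired G ?g" using v by (simp add: unpaired_def)
    ultimately show ?thesis by blast
  qed
  obtain f where f: "optimal_pairing G f" using optimal_pairing_exists[OF G \<alpha>] .
  \<comment> \<open>With \<open>n\<close> vertices, \<open>d\<close> of them unpaired, and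
    \<open>h\<close> for \<open>hadwiger_in Q G\<close>, one has
    \<open>n + d = 2 * chromatic_number G\<close>, which is at least \<open>2 * h + 2\<close> and so
    at least \<open>n + 2\<close>.\<close>
  then have two: "2 \<le> card (unpaired G f)"
    using big less by (simp add: optimal_pairing_def)
  then obtain u where u: "u \<in> unpaired G f" by fastforce
  obtain w where w: "w \<in> unpaired G f" "w \<noteq> u"
  proof -
    have "\<not> unpaired G f \<subseteq> {u}" using two card_mono[of "{u}" "unpaired G f"] by auto
    then show ?thesis using that by blast
  qed
  \<comment> \<open>By the exchange lemma, leaving no two vertices unpaired together is an equivalence
    relation; \<open>A\<close> is the class of \<open>u\<close>, and \<open>G\<close> is the join of \<open>A\<close> with its complement.\<close>
  define A where "A = {a \<in> pverts G. a = u \<or>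
    \<not> (\<exists>g. optimal_pairing G g \<and> a \<in> unpaired G g \<and> u \<in> unpaired G g)}"
  let ?B = "pverts G - A"
  have uA: "u \<in> A" using u by (simp add: A_def unpaired_def)
  \<comment> \<open>The pairing \<open>f\<close> leaves \<open>u\<close> and \<open>w\<close>
    unpaired together, so they lie in different classes and both sides of the join are
    nonempty.\<close>
  have wB: "w \<in> ?B" using f u w by (auto simp: A_def unpaired_def)
  have join: "(a, b) \<in> parcs G" if a: "a \<in> A" and b: "b \<in> ?B" for a b
  proof -
    have "a \<noteq> b" "b \<noteq> u" using a b uA by auto
    obtain g where g: "optimal_pairing G g" "b \<in> unpaired G g" "u \<in> unpaired G g"
      using b by (auto simp: A_def)
    obtain h where "optimal_pairing G h" "a \<in> unpaired G h" "b \<in> unpaired G h"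
    proof (cases "a = u")
      case True
      then show ?thesis using g that by blast
    next
      case False
      have "a \<in> pverts G" using a by (simp add: A_def)
      then obtain g0 where "optimal_pairing G g0" "a \<in> unpaired G g0" using critical by blast
      \<comment> \<open>Exchange, applied to \<open>g\<close> missing \<open>b\<close> and
        \<open>u\<close> and to \<open>g0\<close> missing \<open>a\<close>, yields an optimal
        pairing missing \<open>a\<close> together with \<open>b\<close> or \<open>u\<close>.
        Membership of \<open>a\<close> in \<open>A\<close> rules out \<open>u\<close>.\<close>
      then obtain h where "optimal_pairing G h" "a \<in> unpaired G h"
        "b \<in> unpaired G h \<or> u \<in> unpaired G h"
        using optimal_pairing_exchange[OF G g(1) _ g(2,3) \<open>b \<noteq> u\<close>] by metis
      then show ?thesis using a False that by (auto simp: A_def)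
    qed
    then show ?thesis using optimal_pairing_unpaired_adjacent[OF G] \<open>a \<noteq> b\<close> by blast
  qed
  have AB: "A \<union> ?B = pverts G" "A \<inter> ?B = {}" by (auto simp: A_def)
  have psub: "A \<subset> pverts G" "?B \<subset> pverts G" using uA wB AB by blast+
  have "chromatic_number G \<le> chromatic_number (induced G A) + chromatic_number (induced G ?B)"
    by (rule chromatic_number_Un_le[OF G \<alpha> AB])
  also have "\<dots> \<le> hadwiger_in Q (induced G A) + hadwiger_in Q (induced G ?B)"
    using proper[OF psub(1)] proper[OF psub(2)] by (rule add_mono)
  also have "\<dots> \<le> hadwiger_in Q G"
    using hadwiger_in_join[OF G _ _ AB(2) join] psub by blast
  finally show False using less by simp
qed

text \<open>A counterexample with the fewest vertices is minimal, because proper induced subgraphs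
  have strictly fewer vertices.\<close>

lemma counterexample_in_minimal:
  assumes "counterexample_in Q G"
  obtains H where "induced_minimal (counterexample_in Q) H"
proof -
  obtain H where H: "counterexample_in Q H"
    and least: "\<And>K. counterexample_in Q K \<Longrightarrow> card (pverts H) \<le> card (pverts K)"
    using ex_has_least_nat[of "counterexample_in Q" G "\<lambda>K. card (pverts K)"] assms by blast
  have "induced_minimal (counterexample_in Q) H"
    unfolding induced_minimal_def
    using H least induced_subgraph_card_less[of H]
    by (meson counterexample_in_def not_le)
  then show ?thesis by (rule that)
qed

text \<open>Forwards, colour classes have at most two vertices, so \<open>n\<close> is at most twice
  the chromatic number. Backwards, a failure would give a minimal counterexample, which violates the
  bound on \<open>n\<close>.\<close>

lemma hadwiger_conjecture_iff:
  assumes Q: "\<And>v. Q {v}"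
  shows "(\<forall>G. pair_graph G \<and> independence_number G = 2 \<longrightarrow> chromatic_number G \<le> hadwiger_in Q G)
    \<longleftrightarrow> (\<forall>G. pair_graph G \<and> independence_number G = 2 \<longrightarrow> card (pverts G) \<le> 2 * hadwiger_in Q G)"
    (is "?L \<longleftrightarrow> ?R")
proof
  assume L: ?L
  show ?R
  proof (intro allI impI)
    fix G :: "'a pair_pre_digraph"
    assume "pair_graph G \<and> independence_number G = 2"
    then show "card (pverts G) \<le> 2 * hadwiger_in Q G"
      using L card_le_twice_chromatic_number[of G] by fastforce
  qed
next
  assume R: ?R
  show ?L
  proof (rule ccontr)
    assume "\<not> ?L"
    then obtain G where "counterexample_in Q G" by (auto simp: counterexample_in_def not_le)
    then obtain H where H: "induced_minimal (counterexample_in Q) H"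
      using counterexample_in_minimal by blast
    then have "card (pverts H) \<le> 2 * hadwiger_in Q H"
      using R by (simp add: induced_minimal_def counterexample_in_def)
    then show False using minimal_counterexample_hadwiger_in_less[OF H Q] by simp
  qed
qed

section \<open>Connected dominating matchings\<close>

lemma disconnected_split:
  assumes G: "pair_graph G" and "\<not> Digraph_Component.connected (with_proj G)" "pverts G \<noteq> {}"
  obtains A where "A \<subseteq> pverts G" "A \<noteq> {}" "pverts G - A \<noteq> {}"
    "\<And>a b. a \<in> A \<Longrightarrow> b \<in> pverts G - A \<Longrightarrow> (a, b) \<notin> parcs G"
proof -
  let ?H = "mk_symmetric (with_proj G)"
  have V: "pverts ?H = pverts G" by (simp add: mk_symmetric_def)
  have arcs: "(a, b) \<in> parcs ?H" if "(a, b) \<in> parcs G" for a b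
    using that by (force simp: mk_symmetric_def)
  interpret wf_digraph "with_proj ?H"
    by unfold_locales (use pair_graph_arc_verts[OF G] in \<open>auto simp: mk_symmetric_def\<close>)
  obtain u v where uv: "u \<in> pverts G" "v \<in> pverts G" "\<not> u \<rightarrow>\<^sup>*\<^bsub>with_proj ?H\<^esub> v"
    using assms(2,3) V unfolding Digraph_Component.connected_def strongly_connected_def by auto
  \<comment> \<open>The vertices reachable from \<open>u\<close>; an edge leaving this set would
    make its other end reachable too.\<close>
  let ?A = "{a \<in> pverts G. u \<rightarrow>\<^sup>*\<^bsub>with_proj ?H\<^esub> a}"
  have "u \<in> ?A" using uv V by simp
  moreover have "v \<in> pverts G - ?A" using uv by auto
  moreover have "(a, b) \<notin> parcs G" if "a \<in> ?A" "b \<in> pverts G - ?A" for a b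
  proof
    assume "(a, b) \<in> parcs G"
    then have "a \<rightarrow>\<^bsub>with_proj ?H\<^esub> b" using arcs by simp
    with that show False using reachable_adj_trans[of u a b] by auto
  qed
  ultimately show ?thesis using that[of ?A] by blast
qed

text \<open>Two nonadjacent vertices on one side of a disconnection, with any vertex
  \<open>t\<close> of the other side, would be independent. So both sides are cliques, and the
  larger one contains at least half of the vertices.\<close>

lemma disconnected_hadwiger_in:
  assumes G: "pair_graph G" and \<alpha>: "independence_number G \<le> 2" and Q: "\<And>v. Q {v}"
    and disc: "\<not> Digraph_Component.connected (with_proj G)"
  shows "card (pverts G) \<le> 2 * hadwiger_in Q G"
proof (cases "pverts G = {}")
  case False
  obtain A where A: "A \<subseteq> pverts G" "A \<noteq> {}" "pverts G - A \<noteq> {}"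
    and none: "\<And>a b. a \<in> A \<Longrightarrow> b \<in> pverts G - A \<Longrightarrow> (a, b) \<notin> parcs G"
    using disconnected_split[OF G disc False] by blast
  let ?B = "pverts G - A"
  have clique: "card S \<le> hadwiger_in Q G"
    if S: "S \<subseteq> pverts G" "t \<in> pverts G - S"
      and sep: "\<And>a. a \<in> S \<Longrightarrow> (a, t) \<notin> parcs G" for S t
  proof -
    have "(x, y) \<in> parcs G" if xy: "x \<in> S" "y \<in> S" "x \<noteq> y" for x y
    proof (rule ccontr)
      assume "(x, y) \<notin> parcs G"
      then have "indep_set G {x, y, t}"
        using xy S sep pair_graph_sym[OF G] pair_graph_arc_verts(3)[OF G]
        unfolding indep_set_def by blast
      moreover have "x \<noteq> t" "y \<noteq> t" using xy S by auto
      then have "card {x, y, t} = 3" using xy(3) by simp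
      ultimately show False using card_le_independence_number[OF G] \<alpha> by fastforce
    qed
    then have "card (pverts (induced G S)) \<le> hadwiger_in Q (induced G S)"
      by (intro card_le_hadwiger_in_if_complete pair_graph_induced G S Q) auto
    then show ?thesis using hadwiger_in_induced_le[OF G S(1), of Q] by simp
  qed
  obtain a b where ab: "a \<in> A" "b \<in> ?B" using A by blast
  have "card A \<le> hadwiger_in Q G" using clique[of A b] A ab none by blast
  moreover have "card ?B \<le> hadwiger_in Q G"
    using clique[of ?B a] A ab none pair_graph_sym[OF G] by blast
  moreover have "card (pverts G) = card A + card ?B"
    using A(1) pair_graph_finite[OF G] by (metis card_Diff_subset card_mono finite_subset le_add_diff_inverse)
  ultimately show ?thesis by simp
qed simp

lemma connected_matching_clique_model:
  assumes G: "pair_graph G" and M: "connected_matching G M"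
  shows "clique_model G M"
  unfolding clique_model_def
proof (intro conjI ballI impI)
  fix e assume "e \<in> M"
  then obtain u v where e: "e = {u, v}" "(u, v) \<in> parcs G"
    using M by (auto simp: connected_matching_def is_matching_def edge_set_def)
  then show "e \<subseteq> pverts G" "Digraph_Component.connected (with_proj G \<restriction> e)"
    using pair_graph_arc_verts[OF G] connected_edge[of u v G] by auto
qed (use M in \<open>auto simp: connected_matching_def is_matching_def\<close>)

lemma matching_edge_card:
  assumes "pair_graph G" "is_matching G M" "e \<in> M"
  shows "card e = 2"
  using assms pair_graph_arc_verts(3)[OF assms(1)] by (auto simp: is_matching_def edge_set_def)

lemma card_Union_matching:
  assumes G: "pair_graph G" and M: "is_matching G M"
  shows "card (\<Union>M) = 2 * card M"
proof -
  have "card (\<Union>M) = (\<Sum>e\<in>M. card e)"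
  proof (rule card_Union_disjoint)
    show "pairwise disjnt M" using M by (auto simp: is_matching_def pairwise_def disjnt_def)
    show "finite e" if "e \<in> M" for e
      using matching_edge_card[OF G M that] by (metis card.infinite zero_neq_numeral)
  qed
  also have "\<dots> = (\<Sum>e\<in>M. 2)" using matching_edge_card[OF G M] by (intro sum.cong) auto
  finally show ?thesis by simp
qed

text \<open>Induction on the number of vertices, removing the vertices of a connected dominating
  matching. The claim covers independence number at most 2 and disconnected graphs because the
  remaining graph may be of either kind.\<close>

lemma card_le_hadwiger_in_if_connected_dominating_matchings:
  assumes CDM: "\<And>G :: 'a pair_pre_digraph. pair_graph G \<Longrightarrow>
      Digraph_Component.connected (with_proj G) \<Longrightarrow> independence_number G = 2 \<Longrightarrow>
      \<exists>M. M \<noteq> {} \<and> connected_matching G M \<and> dominating_matching G M"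
    and Q: "\<And>B :: 'a set. card B = 1 \<or> card B = 2 \<Longrightarrow> Q B"
    and "pair_graph G" "independence_number G \<le> 2"
  shows "card (pverts G) \<le> 2 * hadwiger_in Q G"
  using assms(3,4)
proof (induction "card (pverts G)" arbitrary: G rule: less_induct)
  case less
  note G = \<open>pair_graph G\<close> and \<alpha> = \<open>independence_number G \<le> 2\<close>
  have Q1: "Q {v}" for v using Q by simp
  consider "independence_number G \<le> 1" | "\<not> Digraph_Component.connected (with_proj G)"
    | "independence_number G = 2" "Digraph_Component.connected (with_proj G)"
    using \<alpha> by linarith
  then show ?case
  proof cases
    case 1
    have "card (pverts G) \<le> hadwiger_in Q G"
      using card_le_hadwiger_in_if_complete[where Q = Q, OF G Q1]
        adjacent_if_independence_number_le_1[OF G 1] by blast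
    then show ?thesis by simp
  next
    case 2
    then show ?thesis by (rule disconnected_hadwiger_in[where Q = Q, OF G \<alpha> Q1])
  next
    case 3
    obtain M where M: "M \<noteq> {}" "connected_matching G M" "dominating_matching G M"
      using CDM[OF G 3(2,1)] by blast
    have match: "is_matching G M" using M(2) by (simp add: connected_matching_def)
    have M_model: "clique_model G M" by (rule connected_matching_clique_model[OF G M(2)])
    let ?U = "\<Union>M"
    let ?S = "pverts G - ?U"
    have U: "?U \<subseteq> pverts G" using M_model by (auto simp: clique_model_def)
    have finU: "finite ?U" using U pair_graph_finite[OF G] finite_subset by blast
    have card_M: "card ?U = 2 * card M" by (rule card_Union_matching[OF G match])
    have card_V: "card (pverts G) = card ?S + 2 * card M"
      using U finU card_M pair_graph_finite[OF G]
      by (metis card_Diff_subset card_mono le_add_diff_inverse2)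
    have "card M > 0" using M(1) clique_model_finite[OF G M_model] by (simp add: card_gt_0_iff)
    \<comment> \<open>Nonemptiness of \<open>M\<close> makes the remaining graph strictly
      smaller.\<close>
    then have IH: "card ?S \<le> 2 * hadwiger_in Q (induced G ?S)"
      using less.hyps[of "induced G ?S"] card_V pair_graph_induced[OF G, of ?S]
        independence_number_induced_le[OF G, of ?S] \<alpha> by simp
    obtain F where F: "clique_model (induced G ?S) F" "\<And>B. B \<in> F \<Longrightarrow> Q B"
      "card F = hadwiger_in Q (induced G ?S)"
      using hadwiger_in_attained[OF pair_graph_induced[OF G, of ?S]] by (metis Diff_subset)
    have F_model: "clique_model G F" and F_sub: "\<Union>F \<subseteq> ?S"
      using F(1) clique_model_induced[of ?S G] by blast+
    have "A \<inter> B = {}" if "A \<in> F" "B \<in> M" for A B using that F_sub by blast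
    \<comment> \<open>Domination is used here: any vertex of a branch set outside the matching has a
      neighbour on every edge of \<open>M\<close>.\<close>
    moreover have "\<exists>u\<in>A. \<exists>v\<in>B. (u, v) \<in> parcs G" if AB: "A \<in> F" "B \<in> M" for A B
    proof -
      obtain a where a: "a \<in> A" using clique_model_nonempty[OF F_model AB(1)] by blast
      then have "a \<in> ?S" using AB F_sub by blast
      then show ?thesis using M(3) AB(2) a unfolding dominating_matching_def by blast
    qed
    ultimately have "clique_model G (F \<union> M)" "card (F \<union> M) = card F + card M"
      using clique_model_Un[OF F_model M_model _ _ G] by blast+
    moreover have "Q B" if "B \<in> F \<union> M" for B
      using that F(2) Q matching_edge_card[OF G match] by blast
    ultimately have "card F + card M \<le> hadwiger_in Q G"
      using card_le_hadwiger_in[OF G] by metis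
    then show ?thesis using IH F(3) card_V by simp
  qed
qed

section \<open>The two Hadwiger parameters as instances of the results on
  \<open>hadwiger_in\<close>\<close>

theorem theorem2p10:
  shows
  "(\<forall>G :: 'a pair_pre_digraph.
      pair_graph G \<and> independence_number G = 2 \<and> real (had G) < real (card (pverts G)) / 2
      \<longrightarrow> had G < chromatic_number G)
   \<and> (\<forall>G :: 'a pair_pre_digraph.
      induced_minimal HC_counterexample G \<longrightarrow> real (had G) < real (card (pverts G)) / 2)
   \<and> ((\<forall>G :: 'a pair_pre_digraph.
        pair_graph G \<and> independence_number G = 2 \<longrightarrow> had G \<ge> chromatic_number G)
      \<longleftrightarrow>
      (\<forall>G :: 'a pair_pre_digraph.
        pair_graph G \<and> independence_number G = 2 \<longrightarrow> real (had G) \<ge> real (card (pverts G)) / 2))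
   \<and>
   (\<forall>G :: 'a pair_pre_digraph.
      pair_graph G \<and> independence_number G = 2 \<and> int (had2 G) < \<lceil>real (card (pverts G)) / 2\<rceil>
      \<longrightarrow> had2 G < chromatic_number G)
   \<and> (\<forall>G :: 'a pair_pre_digraph.
      induced_minimal SHC_counterexample G \<longrightarrow> int (had2 G) < \<lceil>real (card (pverts G)) / 2\<rceil>)
   \<and> ((\<forall>G :: 'a pair_pre_digraph.
        pair_graph G \<and> independence_number G = 2 \<longrightarrow> had2 G \<ge> chromatic_number G)
      \<longleftrightarrow>
      (\<forall>G :: 'a pair_pre_digraph.
        pair_graph G \<and> independence_number G = 2 \<longrightarrow> int (had2 G) \<ge> \<lceil>real (card (pverts G)) / 2\<rceil>))
   \<and>
   ((\<forall>G :: 'a pair_pre_digraph.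
        pair_graph G \<and> Digraph_Component.connected (with_proj G) \<and> independence_number G = 2
        \<longrightarrow> (\<exists>M. M \<noteq> {} \<and> connected_matching G M \<and> dominating_matching G M))
      \<longrightarrow>
      (\<forall>G :: 'a pair_pre_digraph.
        pair_graph G \<and> independence_number G = 2 \<longrightarrow> had2 G \<ge> chromatic_number G))
   \<and> ((\<forall>G :: 'a pair_pre_digraph.
        pair_graph G \<and> independence_number G = 2 \<longrightarrow> had2 G \<ge> chromatic_number G)
      \<longrightarrow>
      (\<forall>G :: 'a pair_pre_digraph.
        pair_graph G \<and> independence_number G = 2 \<longrightarrow> had G \<ge> chromatic_number G))"
proof -
  let ?T = "\<lambda>B :: 'a set. True" and ?Q = "\<lambda>B :: 'a set. card B = 1 \<or> card B = 2"
  have real_half: "real h < real n / 2 \<longleftrightarrow> 2 * h < n" "real n / 2 \<le> real h \<longleftrightarrow> n \<le> 2 * h"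
    for h n :: nat
    by linarith+
  \<comment> \<open>As \<open>h\<close> is an integer, comparing it with the half or with its
    ceiling gives the same condition on natural numbers, so both parameters are treated
    alike.\<close>
  have ceil_half: "int h < \<lceil>real n / 2\<rceil> \<longleftrightarrow> 2 * h < n" "\<lceil>real n / 2\<rceil> \<le> int h \<longleftrightarrow> n \<le> 2 * h"
    for h n :: nat
    by linarith+
  have bound: "hadwiger_in Q G < chromatic_number G"
    if "pair_graph G" "independence_number G = 2" "2 * hadwiger_in Q G < card (pverts G)"
    for Q and G :: "'a pair_pre_digraph"
    using card_le_twice_chromatic_number[of G] that by simp
  have pg: "pair_graph G"
    if "induced_minimal HC_counterexample G \<or> induced_minimal SHC_counterexample G"
    for G :: "'a pair_pre_digraph"
    using that by (auto simp: induced_minimal_def HC_counterexample_def SHC_counterexample_def)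
  have iff: "(\<forall>G :: 'a pair_pre_digraph. pair_graph G \<and> independence_number G = 2 \<longrightarrow> chromatic_number G \<le> had G)
      \<longleftrightarrow> (\<forall>G :: 'a pair_pre_digraph. pair_graph G \<and> independence_number G = 2
        \<longrightarrow> card (pverts G) \<le> 2 * had G)"
    using hadwiger_conjecture_iff[of ?T] by (simp add: had_eq_hadwiger_in cong: conj_cong imp_cong)
  have iff2: "(\<forall>G :: 'a pair_pre_digraph. pair_graph G \<and> independence_number G = 2 \<longrightarrow> chromatic_number G \<le> had2 G)
      \<longleftrightarrow> (\<forall>G :: 'a pair_pre_digraph. pair_graph G \<and> independence_number G = 2
        \<longrightarrow> card (pverts G) \<le> 2 * had2 G)"
    using hadwiger_conjecture_iff[of ?Q] by (simp add: had2_eq_hadwiger_in cong: conj_cong imp_cong)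
  have minimal: "2 * had G < card (pverts G)"
    if "induced_minimal HC_counterexample G" for G :: "'a pair_pre_digraph"
    using that minimal_counterexample_hadwiger_in_less[of ?T G] pg[of G]
    by (simp add: HC_counterexample_eq had_eq_hadwiger_in)
  have minimal2: "2 * had2 G < card (pverts G)"
    if "induced_minimal SHC_counterexample G" for G :: "'a pair_pre_digraph"
    using that minimal_counterexample_hadwiger_in_less[of ?Q G] pg[of G]
    by (simp add: SHC_counterexample_eq had2_eq_hadwiger_in)
  have had2_le_had: "had2 G \<le> had G" if "pair_graph G" for G :: "'a pair_pre_digraph"
    using hadwiger_in_mono[OF that, of ?Q ?T] that
    by (simp add: had_eq_hadwiger_in had2_eq_hadwiger_in)
  \<comment> \<open>Only the bound by half the vertices comes from matchings; \<open>iff2\<close>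
    turns it into the bound by the chromatic number.\<close>
  have cdm: "card (pverts G) \<le> 2 * had2 G"
    if "\<forall>G :: 'a pair_pre_digraph.
        pair_graph G \<and> Digraph_Component.connected (with_proj G) \<and> independence_number G = 2
        \<longrightarrow> (\<exists>M. M \<noteq> {} \<and> connected_matching G M \<and> dominating_matching G M)"
      and "pair_graph G" "independence_number G = 2" for G :: "'a pair_pre_digraph"
    using card_le_hadwiger_in_if_connected_dominating_matchings[of ?Q G] that
    by (simp add: had2_eq_hadwiger_in)
  show ?thesis
    unfolding real_half ceil_half
  proof (intro conjI)
    show "\<forall>G :: 'a pair_pre_digraph. pair_graph G \<and> independence_number G = 2
        \<and> 2 * had G < card (pverts G) \<longrightarrow> had G < chromatic_number G"
      using bound[of _ ?T] by (auto simp: had_eq_hadwiger_in)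
    show "\<forall>G :: 'a pair_pre_digraph. pair_graph G \<and> independence_number G = 2
        \<and> 2 * had2 G < card (pverts G) \<longrightarrow> had2 G < chromatic_number G"
      using bound[of _ ?Q] by (auto simp: had2_eq_hadwiger_in)
  qed (use iff iff2 minimal minimal2 cdm had2_le_had in \<open>blast intro: le_trans\<close>)+
qed

end
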